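(* Let $0<p<1$, $q=1-p$, and let $\mathcal{M}=(M_k)_{k\ge 0}$ be a sequence of real numbers $M_k\ge 1$ such that $\mu_{\mathcal{M}}=\prod_{k\ge 0}M_k^{p q^{k-1}}=\infty$. Assume either that $$\liminf_{k\to\infty} q^k\log M_k>0,$$ or that all of the following hold: (i) $(\log M_k)_{k\ge0}$ is an increasing and convex sequence; (ii) $\lim_{k\to\infty}q^k\log M_k=0$; (iii) $\liminf_{k\to\infty}\frac{\log M_k}{P(k)}=\infty$ for every real polynomial $P$ with positive leading coefficient. Then there is no constant $C$ such that $$\|f\|_\infty\le C\|f\|_{\mathcal{M}}\quad\text{for all } f\in\mathcal{S}.$$
   Context: For measurable $f$ on $\mathbb{R}$, $\|f\|_p=\left(\int_{\mathbb{R}}|f(x)|^p\,dx\right)^{1/p}$, and $\|f\|_\infty$ is the supremum norm on $\mathbb{R}$. For $f\in C^\infty(\mathbb{R})$ put $\|f\|_{\mathcal{M}}=\sup_{k\ge0}\frac{\|f^{(k)}\|_p}{M_k}$. The class $\mathcal{S}$ (depending on $p$ and $\mathcal{M}$) is $$\mathcal{S}=\left\{f\in C^\infty(\mathbb{R}) : \|f\|_{\mathcal{M}}<\infty \text{ and } \limsup_{k\to\infty}\|f^{(k)}\|_\infty^{q^k}\le 1\right\}.$$ "Increasing" means non-decreasing; a sequence $(x_k)_{k\ge0}$ is convex if $x_k+x_{k-2}-2x_{k-1}\ge0$ for all $k\ge2$. *)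

theory Defs
  imports "HOL-Analysis.Analysis" "HOL-Computational_Algebra.Polynomial"
begin

text \<open>
  Functions on the real line take values in a type of class \<open>real_normed_field\<close>; this treats
  real-valued and complex-valued functions uniformly. All norms take values in \<open>ennreal\<close>, because
  they may be infinite for functions outside the class under consideration.
\<close>

text \<open>
  Only exponents \<open>a > 0\<close> are meaningful here; then \<open>\<infinity>\<close> to the power \<open>a\<close> is \<open>\<infinity>\<close> and \<open>0\<close> to the
  power \<open>a\<close> is \<open>0\<close>.
\<close>
definition ennreal_powr :: "ennreal \<Rightarrow> real \<Rightarrow> ennreal" where
  "ennreal_powr x a = (if x = \<infinity> then \<infinity> else ennreal (enn2real x powr a))"

definition Lp_norm :: "real \<Rightarrow> (real \<Rightarrow> 'a::real_normed_field) \<Rightarrow> ennreal" where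
  "Lp_norm p f = ennreal_powr (\<integral>\<^sup>+ x. ennreal (norm (f x) powr p) \<partial>lebesgue) (1 / p)"

definition sup_norm :: "(real \<Rightarrow> 'a::real_normed_field) \<Rightarrow> ennreal" where
  "sup_norm f = (SUP x. ennreal (norm (f x)))"

definition nth_deriv :: "nat \<Rightarrow> (real \<Rightarrow> 'a::real_normed_field) \<Rightarrow> real \<Rightarrow> 'a" where
  "nth_deriv k f = ((\<lambda>g x. vector_derivative g (at x)) ^^ k) f"

definition smooth :: "(real \<Rightarrow> 'a::real_normed_field) \<Rightarrow> bool" where
  "smooth f \<longleftrightarrow> (\<forall>k x. nth_deriv k f differentiable (at x))"

definition weighted_norm :: "real \<Rightarrow> (nat \<Rightarrow> real) \<Rightarrow> (real \<Rightarrow> 'a::real_normed_field) \<Rightarrow> ennreal" where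
  "weighted_norm p M f = (SUP k. Lp_norm p (nth_deriv k f) / ennreal (M k))"

definition class_S :: "real \<Rightarrow> (nat \<Rightarrow> real) \<Rightarrow> (real \<Rightarrow> 'a::real_normed_field) set" where
  "class_S p M =
     {f. smooth f \<and> weighted_norm p M f < \<infinity> \<and>
         limsup (\<lambda>k. ennreal_powr (sup_norm (nth_deriv k f)) ((1 - p) ^ k)) \<le> 1}"

text \<open>
  Divergence of the product to \<open>\<infinity>\<close>, as divergence of its partial products. The exponent of the
  factor with index \<open>0\<close> is \<open>p / q\<close>, whence the integer power \<open>powi\<close>.
\<close>
definition mu_infinite :: "real \<Rightarrow> (nat \<Rightarrow> real) \<Rightarrow> bool" where
  "mu_infinite p M \<longleftrightarrow>
     filterlim (\<lambda>n. \<Prod>k<n. M k powr (p * (1 - p) powi (int k - 1))) at_top sequentially"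

definition convex_seq :: "(nat \<Rightarrow> real) \<Rightarrow> bool" where
  "convex_seq x \<longleftrightarrow> (\<forall>k\<ge>2. x k + x (k - 2) - 2 * x (k - 1) \<ge> 0)"

end

theory Submission
  imports Defs
begin

text \<open>
  The estimate \<open>\<parallel>f\<parallel>\<^sub>\<infinity> \<le> \<parallel>f'\<parallel>\<^sub>1 \<le> \<parallel>f'\<parallel>\<^sub>\<infinity>\<^sup>q \<parallel>f'\<parallel>\<^sub>p\<^sup>p\<close>, iterated, bounds \<open>\<parallel>f\<parallel>\<^sub>\<infinity>\<close> by a product of powers of the
  \<open>\<parallel>f\<^sup>(\<^sup>k\<^sup>)\<parallel>\<^sub>p\<close>. It is nearly sharp when each derivative consists of few narrow bumps, as for an infinite
  convolution of box functions whose widths \<open>a\<^sub>0 > a\<^sub>1 > \<dots>\<close> shrink at least geometrically. Scaled to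
  have supremum 1, it satisfies
  \<open>\<parallel>f\<^sup>(\<^sup>k\<^sup>)\<parallel>\<^sub>\<infinity> \<le> 2\<^sup>k\<^sup>+\<^sup>1 / (a\<^sub>1 \<dots> a\<^sub>k)\<close> and
  \<open>\<parallel>f\<^sup>(\<^sup>k\<^sup>)\<parallel>\<^sub>p\<^sup>p \<le> 2\<^sup>k\<^sup>+\<^sup>1 a\<^sub>k / (a\<^sub>1 \<dots> a\<^sub>k)\<^sup>p\<close>.
  With \<open>e\<^sub>k = - log (a\<^sub>1 \<dots> a\<^sub>k)\<close> up to a constant, making the norm of \<open>f\<close> small amounts, up to
  lower order terms, to \<open>e\<^sub>k \<le> q e\<^sub>k\<^sub>+\<^sub>1 + p log M\<^sub>k\<^sub>+\<^sub>1\<close> with \<open>e\<^sub>0\<close> large, while \<open>f\<close> lies in the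
  class if \<open>q\<^sup>k e\<^sub>k \<rightarrow> 0\<close>. Averages \<open>\<Sum>\<^sub>j p q\<^sup>j y\<^sub>k\<^sub>+\<^sub>1\<^sub>+\<^sub>j\<close> of a convex \<open>y\<close>, a minorant of \<open>log M\<close> up to a constant, solve
  this, and \<open>e\<^sub>0\<close> becomes large because \<open>\<mu>\<close> is infinite. The minorant is \<open>log M / 2\<close> or, in the first
  case, a multiple of \<open>q\<^sup>-\<^sup>k\<close>; the part of \<open>log M\<close> above it absorbs the lower order terms.
\<close>

section \<open>Averages over a moving window\<close>

text \<open>Convolution of \<open>h\<close> with the uniform density on [0, a].\<close>

definition avg :: "real \<Rightarrow> (real \<Rightarrow> real) \<Rightarrow> real \<Rightarrow> real" where
  "avg a h x = integral {x - a..x} h / a"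

definition ramp :: "real \<Rightarrow> real \<Rightarrow> real" where
  "ramp c x = min 1 (max 0 (1 + x / c))"

lemma integral_moving_split:
  fixes h :: "real \<Rightarrow> real"
  assumes "\<And>u v. h integrable_on {u..v}" and "0 \<le> a" and "c \<le> x - a"
  shows "integral {x - a..x} h = integral {c..x} h - integral {c..x - a} h"
  using Henstock_Kurzweil_Integration.integral_combine[of c "x - a" x h] assms by simp

text \<open>Integrability of \<open>h\<close> suffices here: for the limit \<open>box_cdf\<close> it
  is known before continuity. Averaging once gives continuity, and then
  \<open>avg_has_real_derivative\<close> gives differentiability.\<close>

lemma isCont_avg:
  assumes int: "\<And>u v. h integrable_on {u..v}" and "0 < a"
  shows "isCont (avg a h) x"
proof -
  \<comment> \<open>A base point left of every window [y - a, y] with |y - x| < 1, so that near x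
    the average is a difference of two values of one indefinite integral.\<close>
  define c where "c = x - a - 1"
  define I where "I y = integral {c..y} h" for y
  have cI: "isCont I y" if "c < y" for y
  proof -
    have "continuous_on {c..y + 1} I"
      unfolding I_def by (rule indefinite_integral_continuous_1) (rule int)
    then show ?thesis using that
      by (intro continuous_on_interior[of "{c..y+1}"]) (auto simp: interior_atLeastAtMost_real)
  qed
  have "isCont (\<lambda>y. (I y - I (y - a)) / a) x"
    using \<open>0 < a\<close> by (intro continuous_intros cI isCont_o2[where g = I and f = "\<lambda>y. y - a"])
      (auto simp: c_def)
  moreover have "\<forall>\<^sub>F y in nhds x. avg a h y = (I y - I (y - a)) / a"
  proof -
    have "\<forall>\<^sub>F y in nhds x. y \<in> {x - 1<..<x + 1}"
      by (rule eventually_nhds_in_open) auto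
    then show ?thesis
      by eventually_elim
        (use \<open>0 < a\<close> in \<open>auto simp: avg_def I_def c_def intro!: integral_moving_split int\<close>)
  qed
  ultimately show ?thesis using isCont_cong by fast
qed

lemma avg_has_real_derivative:
  assumes cont: "\<And>x. isCont h x" and "0 < a"
  shows "(avg a h has_real_derivative (h x - h (x - a)) / a) (at x)"
proof -
  have cont': "continuous_on S h" for S
    using cont by (simp add: continuous_at_imp_continuous_on)
  then have int: "h integrable_on {u..v}" for u v
    by (rule integrable_continuous_real)
  define c where "c = x - a - 1"
  define I where "I y = integral {c..y} h" for y
  have dI: "(I has_real_derivative h y) (at y)" if "c < y" for y
  proof -
    have "(I has_real_derivative h y) (at y within {c..y + 1})"
      unfolding I_def by (rule integral_has_real_derivative) (use that cont' in auto)
    then show ?thesis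
      using that at_within_interior[of y "{c..y+1}"] by (simp add: interior_atLeastAtMost_real)
  qed
  have "((\<lambda>y. I (y - a)) has_real_derivative h (x - a) * 1) (at x)"
    by (rule DERIV_chain2[where f = I], rule dI) (auto simp: c_def intro!: derivative_eq_intros)
  then have "((\<lambda>y. (I y - I (y - a)) / a) has_real_derivative (h x - h (x - a)) / a) (at x)"
    using \<open>0 < a\<close> by (auto intro!: derivative_eq_intros dI simp: c_def)
  moreover have "\<forall>\<^sub>F y in nhds x. avg a h y = (I y - I (y - a)) / a"
  proof -
    have "\<forall>\<^sub>F y in nhds x. y \<in> {x - 1<..<x + 1}"
      by (rule eventually_nhds_in_open) auto
    then show ?thesis
      by eventually_elim
        (use \<open>0 < a\<close> in \<open>auto simp: avg_def I_def c_def intro!: integral_moving_split int\<close>)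
  qed
  ultimately show ?thesis
    by (subst DERIV_cong_ev[OF refl _ refl])
qed

lemma avg_le_of_le:
  assumes "h integrable_on {x - a..x}" "0 < a" "\<And>y. y \<in> {x - a..x} \<Longrightarrow> h y \<le> B"
  shows "avg a h x \<le> B"
proof -
  have "integral {x - a..x} h \<le> integral {x - a..x} (\<lambda>_. B)"
    by (rule integral_le) (use assms in auto)
  then show ?thesis using assms(2) by (simp add: avg_def field_simps)
qed

lemma le_avg_of_le:
  assumes "h integrable_on {x - a..x}" "0 < a" "\<And>y. y \<in> {x - a..x} \<Longrightarrow> B \<le> h y"
  shows "B \<le> avg a h x"
proof -
  have "integral {x - a..x} (\<lambda>_. B) \<le> integral {x - a..x} h"
    by (rule integral_le) (use assms in auto)
  then show ?thesis using assms(2) by (simp add: avg_def field_simps)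
qed

lemma avg_mono:
  assumes "h integrable_on {x - a..x}" "g integrable_on {x - a..x}" "0 < a"
    "\<And>y. y \<in> {x - a..x} \<Longrightarrow> h y \<le> g y"
  shows "avg a h x \<le> avg a g x"
  using assms by (auto simp: avg_def intro!: divide_right_mono integral_le)

text \<open>Translating the later window onto the earlier one reduces this to a pointwise comparison
  of \<open>h\<close> with its shift.\<close>

lemma mono_avg:
  assumes int: "\<And>u v. h integrable_on {u..v}" and "0 < a" and "mono h"
  shows "mono (avg a h)"
proof
  fix x y :: real assume "x \<le> y"
  have "((\<lambda>t. h (t + (y - x))) has_integral integral {y - a..y} h) {x - a..x}"
    using has_integral_affinity[OF integrable_integral[OF int[of "y - a" y, folded cbox_interval]], of 1 "y - x"]
    using image_add_atLeastAtMost[of "x - y" "y - a" y] by (simp add: algebra_simps image_def)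
  with integrable_integral[OF int] have "integral {x - a..x} h \<le> integral {y - a..y} h"
    by (rule has_integral_le) (use \<open>mono h\<close> \<open>x \<le> y\<close> in \<open>auto intro: monoD\<close>)
  then show "avg a h x \<le> avg a h y"
    using \<open>0 < a\<close> by (simp add: avg_def divide_right_mono)
qed

section \<open>Iterated averages and their limit\<close>

text \<open>Averages \<open>ramp (a (k + i))\<close> over windows of widths \<open>a k\<close>, ...,
  \<open>a (k + i - 1)\<close>. The width \<open>a k\<close> is applied last, so that
  differentiation removes it and leaves the same construction at \<open>Suc k\<close>.\<close>

primrec iter_avg :: "(nat \<Rightarrow> real) \<Rightarrow> nat \<Rightarrow> nat \<Rightarrow> real \<Rightarrow> real" where
  "iter_avg a 0 = (\<lambda>k. ramp (a k))"
| "iter_avg a (Suc i) = (\<lambda>k. avg (a k) (iter_avg a i (Suc k)))"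

text \<open>Under halving the widths from index k on sum to at most \<open>2 * a k\<close>, which
  confines the rise of \<open>box_cdf k\<close> from 0 to 1 to [0, 2 * a k].\<close>

locale halving_seq =
  fixes a :: "nat \<Rightarrow> real"
  assumes a_pos: "\<And>k. 0 < a k" and a_half: "\<And>k. a (Suc k) \<le> a k / 2"
begin

lemma continuous_iter_avg: "isCont (iter_avg a i k) x"
proof (induction i arbitrary: k x)
  case 0
  then show ?case using a_pos[of k] by (auto simp: ramp_def[abs_def] intro!: continuous_intros)
next
  case (Suc i)
  then have "iter_avg a i (Suc k) integrable_on {u..v}" for u v
    by (auto intro!: integrable_continuous_real continuous_at_imp_continuous_on)
  then show ?case using isCont_avg[OF _ a_pos] by simp
qed

lemma integrable_iter_avg: "iter_avg a i k integrable_on {u..v}"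
  by (auto intro!: integrable_continuous_real continuous_at_imp_continuous_on continuous_iter_avg)

lemma mono_iter_avg: "mono (iter_avg a i k)"
proof (induction i arbitrary: k)
  case 0
  then show ?case using a_pos[of k] 
    by (auto intro!: monoI min.mono max.mono divide_right_mono simp: ramp_def simp del: min.bounded_iff max.bounded_iff)
next
  case (Suc i)
  then show ?case by (auto intro!: mono_avg a_pos integrable_iter_avg)
qed

lemma iter_avg_bounds: "0 \<le> iter_avg a i k x" "iter_avg a i k x \<le> 1"
proof (induction i arbitrary: k x)
  case 0
  { case 1 then show ?case by (simp add: ramp_def) next
    case 2 then show ?case by (simp add: ramp_def) }
next
  case (Suc i)
  { case 1 then show ?case using Suc by (auto intro!: le_avg_of_le a_pos integrable_iter_avg) next
    case 2 then show ?case using Suc by (auto intro!: avg_le_of_le a_pos integrable_iter_avg) }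
qed

text \<open>Averaging to the left never moves the zero set's right end to the left, so only the ramp
  reaches below 0; its width vanishes as i grows.\<close>

lemma iter_avg_eq_0: "x \<le> - a (k + i) \<Longrightarrow> iter_avg a i k x = 0"
proof (induction i arbitrary: k x)
  case 0
  then show ?case using a_pos[of k] by (simp add: ramp_def field_simps max_def)
next
  case (Suc i)
  have "iter_avg a (Suc i) k x \<le> 0"
    using Suc by (auto intro!: avg_le_of_le a_pos integrable_iter_avg simp: Suc.IH)
  with iter_avg_bounds(1) show ?case by (meson antisym)
qed

text \<open>For x \<ge> \<open>2 * a k\<close> the whole window [x - a k, x] lies to the right of
  \<open>a k\<close>, hence of \<open>2 * a (Suc k)\<close>.\<close>

lemma iter_avg_eq_1: "2 * a k \<le> x \<Longrightarrow> iter_avg a i k x = 1"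
proof (induction i arbitrary: k x)
  case 0
  then show ?case using a_pos[of k] by (simp add: ramp_def field_simps max_def)
next
  case (Suc i)
  have "iter_avg a i (Suc k) y = 1" if "y \<in> {x - a k..x}" for y
    using Suc.prems that a_half[of k] by (intro Suc.IH) auto
  then have "iter_avg a (Suc i) k x \<ge> 1"
    by (auto intro!: le_avg_of_le a_pos integrable_iter_avg)
  with iter_avg_bounds(2) show ?case by (meson antisym)
qed

text \<open>
  Averaging an increasing function to the left decreases it, and the ramp occupies \<open>[-c, 0]\<close> rather
  than \<open>[0, c]\<close> so that it too decreases with \<open>c\<close>. Hence the approximations are monotone in \<open>i\<close>.
\<close>

lemma iter_avg_Suc_le: "iter_avg a (Suc i) k x \<le> iter_avg a i k x"
proof (induction i arbitrary: k x)
  case 0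
  have "avg (a k) (iter_avg a 0 (Suc k)) x \<le> iter_avg a 0 (Suc k) x"
    by (rule avg_le_of_le[OF integrable_iter_avg a_pos]) (auto intro: monoD[OF mono_iter_avg] simp del: iter_avg.simps)
  also have "\<dots> \<le> iter_avg a 0 k x"
  proof (cases "x \<le> 0")
    case True
    have "x * a k \<le> x * a (Suc k)" 
      using True a_half[of k] a_pos[of k] by (intro mult_left_mono_neg) auto
    then have "x / a (Suc k) \<le> x / a k" using a_pos[of k] a_pos[of "Suc k"]
      by (simp add: field_simps)
    then show ?thesis by (auto simp: ramp_def)
  next
    case False
    then show ?thesis using a_pos[of k] by (auto simp: ramp_def)
  qed
  finally show ?case by simp
next
  case (Suc i)
  have "avg (a k) (iter_avg a (Suc i) (Suc k)) x \<le> avg (a k) (iter_avg a i (Suc k)) x"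
    by (rule avg_mono[OF integrable_iter_avg integrable_iter_avg a_pos]) (rule Suc.IH)
  then show ?case by simp
qed

text \<open>The distribution function of \<open>\<Sum>j\<ge>k. a j * U j\<close> with independent uniform \<open>U j\<close> on \<open>[0, 1]\<close>.\<close>

definition box_cdf :: "nat \<Rightarrow> real \<Rightarrow> real" where
  "box_cdf k x = lim (\<lambda>i. iter_avg a i k x)"

lemma iter_avg_tendsto: "(\<lambda>i. iter_avg a i k x) \<longlonglongrightarrow> box_cdf k x"
proof -
  have "decseq (\<lambda>i. iter_avg a i k x)"
    using iter_avg_Suc_le by (intro decseq_SucI)
  then have "convergent (\<lambda>i. iter_avg a i k x)"
    using iter_avg_bounds(1)[of _ k x] by (metis decseq_convergent convergentI)
  then show ?thesis by (simp add: box_cdf_def convergent_LIMSEQ_iff)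
qed

lemma box_cdf_bounds: "0 \<le> box_cdf k x" "box_cdf k x \<le> 1"
  by (rule LIMSEQ_le_const[OF iter_avg_tendsto] LIMSEQ_le_const2[OF iter_avg_tendsto],
      use iter_avg_bounds in blast)+

lemma box_cdf_eq_1: "2 * a k \<le> x \<Longrightarrow> box_cdf k x = 1"
  using iter_avg_tendsto[of k x] by (simp add: iter_avg_eq_1 LIMSEQ_const_iff)

lemma a_le_power: "a k \<le> a 0 / 2 ^ k"
proof (induction k)
  case (Suc k)
  have "a (Suc k) \<le> a k / 2" by (rule a_half)
  also have "\<dots> \<le> (a 0 / 2 ^ k) / 2" using Suc by (intro divide_right_mono) auto
  finally show ?case by (simp add: mult.commute)
qed simp

lemma a_tendsto_0: "a \<longlonglongrightarrow> 0"
proof (rule tendsto_sandwich[OF _ _ tendsto_const])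
  show "(\<lambda>k. a 0 / 2 ^ k) \<longlonglongrightarrow> 0"
    using tendsto_mult_right_zero[OF LIMSEQ_power_zero[of "1/2::real"], of "a 0"]
    by (simp add: power_one_over)
qed (use a_pos a_le_power in \<open>auto intro: always_eventually less_imp_le\<close>)

lemma box_cdf_eq_0:
  assumes "x < 0" shows "box_cdf k x = 0"
proof -
  have "(\<lambda>i. a (k + i)) \<longlonglongrightarrow> 0"
    using LIMSEQ_ignore_initial_segment[OF a_tendsto_0, of k] by (simp add: add.commute)
  then have "\<forall>\<^sub>F i in sequentially. a (k + i) < - x"
    using assms by (intro order_tendstoD(2)) auto
  then have "\<forall>\<^sub>F i in sequentially. iter_avg a i k x = 0"
    by eventually_elim (simp add: iter_avg_eq_0)
  then have "(\<lambda>i. iter_avg a i k x) \<longlonglongrightarrow> 0"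
    by (rule tendsto_eventually)
  with iter_avg_tendsto show ?thesis
    by (rule LIMSEQ_unique)
qed

text \<open>Dominated convergence with the bound 1 carries the recursion of \<open>iter_avg\<close>
  over to the limit.\<close>

lemma
  shows integrable_box_cdf: "box_cdf k integrable_on {u..v}"
    and box_cdf_eq_avg: "box_cdf k x = avg (a k) (box_cdf (Suc k)) x"
proof -
  have *: "box_cdf k integrable_on {u..v}"
    "(\<lambda>i. integral {u..v} (iter_avg a i k)) \<longlonglongrightarrow> integral {u..v} (box_cdf k)" for k u v
  proof -
    have one: "(\<lambda>_. 1 :: real) integrable_on {u..v}" by auto
    have le: "norm (iter_avg a i k x) \<le> 1" for i x
      using iter_avg_bounds[of i k x] by simp
    show "box_cdf k integrable_on {u..v}"
      by (rule dominated_convergence(1)[OF integrable_iter_avg one le iter_avg_tendsto])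
    show "(\<lambda>i. integral {u..v} (iter_avg a i k)) \<longlonglongrightarrow> integral {u..v} (box_cdf k)"
      by (rule dominated_convergence(2)[OF integrable_iter_avg one le iter_avg_tendsto])
  qed
  then show "box_cdf k integrable_on {u..v}" by simp
  have "(\<lambda>i. iter_avg a (Suc i) k x) \<longlonglongrightarrow> avg (a k) (box_cdf (Suc k)) x"
    using a_pos[of k] *(2)[of "x - a k" x "Suc k"] by (auto simp: avg_def intro!: tendsto_divide)
  moreover have "(\<lambda>i. iter_avg a (Suc i) k x) \<longlonglongrightarrow> box_cdf k x"
    by (rule LIMSEQ_Suc) (rule iter_avg_tendsto)
  ultimately show "box_cdf k x = avg (a k) (box_cdf (Suc k)) x"
    by (rule LIMSEQ_unique[rotated])
qed

lemma box_cdf_eq_avg': "box_cdf k = avg (a k) (box_cdf (Suc k))"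
  by (rule ext) (rule box_cdf_eq_avg)

lemma isCont_box_cdf: "isCont (box_cdf k) x"
  by (subst box_cdf_eq_avg') (rule isCont_avg[OF integrable_box_cdf a_pos])

lemma box_cdf_has_real_derivative:
  "(box_cdf k has_real_derivative (box_cdf (Suc k) x - box_cdf (Suc k) (x - a k)) / a k) (at x)"
  by (subst box_cdf_eq_avg') (rule avg_has_real_derivative[OF isCont_box_cdf a_pos])

end

section \<open>Derivatives of the limit and their p-th power integrals\<close>

text \<open>The shares of x and y in x + y lie in [0, 1], where t \<le> t^p, and they sum to
  1.\<close>

lemma powr_add_le:
  fixes x y p :: real
  assumes "0 \<le> x" "0 \<le> y" "0 < p" "p \<le> 1"
  shows "(x + y) powr p \<le> x powr p + y powr p"
proof (cases "x + y = 0")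
  case True
  then show ?thesis using assms by simp
next
  case False
  then have pos: "0 < x + y" using assms by simp
  have *: "t / (x + y) \<le> (t / (x + y)) powr p" if "0 \<le> t" "t \<le> x + y" for t
    using powr_mono'[of p 1 "t / (x + y)"] that pos assms by (cases "t = 0") auto
  have "1 = x / (x + y) + y / (x + y)" using pos by (simp add: add_divide_distrib[symmetric])
  also have "\<dots> \<le> (x / (x + y)) powr p + (y / (x + y)) powr p"
    using assms by (intro add_mono *) auto
  also have "\<dots> = (x powr p + y powr p) / (x + y) powr p"
    using assms pos by (simp add: powr_divide add_divide_distrib)
  finally show ?thesis using pos by (simp add: field_simps)
qed

lemma nn_integral_lborel_translate:
  assumes [measurable]: "f \<in> borel_measurable borel"
  shows "(\<integral>\<^sup>+ x. f (x - c) \<partial>lborel) = (\<integral>\<^sup>+ x. f (x :: real) \<partial>lborel)"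
  using nn_integral_real_affine[OF assms, of 1 "- c"] by simp

text \<open>The candidate for the k-th derivative of \<open>box_cdf j\<close>: a signed sum of 2^k
  translates of \<open>box_cdf (j + k)\<close>, divided by \<open>a j\<close>, ...,
  \<open>a (j + k - 1)\<close>.\<close>

primrec cdf_deriv :: "(nat \<Rightarrow> real) \<Rightarrow> nat \<Rightarrow> nat \<Rightarrow> real \<Rightarrow> real" where
  "cdf_deriv a 0 = (\<lambda>j. halving_seq.box_cdf a j)"
| "cdf_deriv a (Suc k) =
     (\<lambda>j x. (cdf_deriv a k (Suc j) x - cdf_deriv a k (Suc j) (x - a j)) / a j)"

context halving_seq
begin

lemma cdf_deriv_has_real_derivative:
  "(cdf_deriv a k j has_real_derivative cdf_deriv a (Suc k) j x) (at x)"
proof (induction k arbitrary: j x)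
  case 0
  then show ?case using box_cdf_has_real_derivative by simp
next
  case (Suc k)
  have "((\<lambda>y. cdf_deriv a k (Suc j) (y - a j)) has_real_derivative
      cdf_deriv a (Suc k) (Suc j) (x - a j) * 1) (at x)"
    by (rule DERIV_chain2[where f = "cdf_deriv a k (Suc j)"], rule Suc.IH)
      (auto intro!: derivative_eq_intros)
  then have "((\<lambda>y. (cdf_deriv a k (Suc j) y - cdf_deriv a k (Suc j) (y - a j)) / a j)
      has_real_derivative
        (cdf_deriv a (Suc k) (Suc j) x - cdf_deriv a (Suc k) (Suc j) (x - a j) * 1) / a j) (at x)"
    by (intro DERIV_cdivide DERIV_diff Suc.IH)
  then show ?case by simp
qed

lemma measurable_cdf_deriv [measurable]: "cdf_deriv a k j \<in> borel_measurable borel"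
  by (intro borel_measurable_continuous_onI continuous_at_imp_continuous_on ballI
      DERIV_isCont[OF cdf_deriv_has_real_derivative])

lemma prod_a_pos: "0 < (\<Prod>i<k. a (j + i))"
  by (intro prod_pos) (auto simp: a_pos)

lemma prod_a_Suc: "(\<Prod>i<Suc k. a (j + i)) = a j * (\<Prod>i<k. a (Suc j + i))"
  by (subst prod.lessThan_Suc_shift) simp

text \<open>Each difference quotient at most doubles the bound and divides it by one width.\<close>

lemma cdf_deriv_bound: "\<bar>cdf_deriv a k j x\<bar> \<le> 2 ^ k / (\<Prod>i<k. a (j + i))"
proof (induction k arbitrary: j x)
  case 0
  then show ?case using box_cdf_bounds[of j x] by simp
next
  case (Suc k)
  let ?P = "\<Prod>i<k. a (Suc j + i)"
  have "\<bar>cdf_deriv a (Suc k) j x\<bar> \<le>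
      (\<bar>cdf_deriv a k (Suc j) x\<bar> + \<bar>cdf_deriv a k (Suc j) (x - a j)\<bar>) / a j"
    using a_pos[of j] by (auto simp: abs_divide intro!: divide_right_mono)
  also have "\<dots> \<le> (2 ^ k / ?P + 2 ^ k / ?P) / a j"
    using a_pos[of j] by (intro divide_right_mono add_mono Suc.IH) auto
  also have "\<dots> = 2 ^ Suc k / (\<Prod>i<Suc k. a (j + i))"
    using prod_a_pos[of "Suc j" k] a_pos[of j] unfolding prod_a_Suc by (simp add: field_simps)
  finally show ?case .
qed

lemma cdf_deriv_1_bound: "\<bar>cdf_deriv a (Suc 0) j x\<bar> \<le> 1 / a j * indicator {0..2 * a j} x"
proof (cases "x \<in> {0..2 * a j}")
  case True
  have "\<bar>box_cdf (Suc j) x - box_cdf (Suc j) (x - a j)\<bar> \<le> 1"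
    using box_cdf_bounds[of "Suc j" x] box_cdf_bounds[of "Suc j" "x - a j"] by simp
  then show ?thesis using True a_pos[of j] by (simp add: abs_divide divide_right_mono)
next
  case False
  then consider "x < 0" | "2 * a j < x" by force
  then have "box_cdf (Suc j) x = box_cdf (Suc j) (x - a j)"
  proof cases
    case 1
    then show ?thesis using a_pos[of j] by (simp add: box_cdf_eq_0)
  next
    case 2
    then show ?thesis using a_half[of j] a_pos[of j] by (simp add: box_cdf_eq_1)
  qed
  then show ?thesis using False by simp
qed

text \<open>The derivative of order k + 1 is a signed sum of 2^k bumps of length
  \<open>2 * a (j + k)\<close>, each bounded by the inverse product of the widths; for p \<le> 1 the
  p-th powers add up. The induction starts at the first derivative because \<open>box_cdf\<close>
  tends to 1 at infinity and is not integrable.\<close>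

lemma nn_integral_cdf_deriv:
  assumes "0 < p" "p \<le> 1"
  shows "(\<integral>\<^sup>+ x. ennreal (\<bar>cdf_deriv a (Suc k) j x\<bar> powr p) \<partial>lborel)
    \<le> ennreal (2 ^ Suc k * a (j + k) / (\<Prod>i<Suc k. a (j + i)) powr p)"
proof (induction k arbitrary: j)
  case 0
  have "ennreal (\<bar>cdf_deriv a (Suc 0) j x\<bar> powr p)
      \<le> ennreal ((1 / a j) powr p) * indicator {0..2 * a j} x" for x
  proof (cases "x \<in> {0..2 * a j}")
    case True
    then show ?thesis
      using powr_mono2[of p, OF _ _ cdf_deriv_1_bound[of j x]] assms
      by (simp add: ennreal_leI del: cdf_deriv.simps)
  next
    case False
    then have "cdf_deriv a (Suc 0) j x = 0"
      using cdf_deriv_1_bound[of j x] by (simp del: cdf_deriv.simps)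
    then show ?thesis by (simp del: cdf_deriv.simps)
  qed
  then have "(\<integral>\<^sup>+ x. ennreal (\<bar>cdf_deriv a (Suc 0) j x\<bar> powr p) \<partial>lborel)
      \<le> (\<integral>\<^sup>+ x. ennreal ((1 / a j) powr p) * indicator {0..2 * a j} x \<partial>lborel)"
    by (intro nn_integral_mono)
  also have "\<dots> = ennreal (2 ^ Suc 0 * a (j + 0) / (\<Prod>i<Suc 0. a (j + i)) powr p)"
    using a_pos[of j] by (simp add: nn_integral_cmult_indicator ennreal_mult[symmetric] powr_divide)
  finally show ?case .
next
  case (Suc k)
  let ?g = "\<lambda>x. ennreal (\<bar>cdf_deriv a (Suc k) (Suc j) x\<bar> powr p)"
  let ?P = "\<Prod>i<Suc k. a (Suc j + i)"
  let ?B = "2 ^ Suc k * a (Suc j + k) / ?P powr p"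
  let ?c = "ennreal (a j powr - p)"
  have B: "0 \<le> ?B" using a_pos[of "Suc j + k"] by simp
  have "ennreal (\<bar>cdf_deriv a (Suc (Suc k)) j x\<bar> powr p) \<le> ?c * (?g x + ?g (x - a j))" for x
  proof -
    let ?u = "cdf_deriv a (Suc k) (Suc j) x" and ?v = "cdf_deriv a (Suc k) (Suc j) (x - a j)"
    have "\<bar>cdf_deriv a (Suc (Suc k)) j x\<bar> powr p = \<bar>?u - ?v\<bar> powr p / a j powr p"
      using a_pos[of j] by (subst cdf_deriv.simps(2)) (simp add: abs_divide powr_divide)
    also have "\<dots> \<le> (\<bar>?u\<bar> powr p + \<bar>?v\<bar> powr p) / a j powr p"
      using assms
      by (intro divide_right_mono order_trans[OF powr_mono2[OF _ _ abs_triangle_ineq4] powr_add_le])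
        (auto simp del: cdf_deriv.simps)
    finally have "ennreal (\<bar>cdf_deriv a (Suc (Suc k)) j x\<bar> powr p)
        \<le> ennreal (a j powr - p * (\<bar>?u\<bar> powr p + \<bar>?v\<bar> powr p))"
      by (intro ennreal_leI) (simp add: powr_minus_divide)
    also have "\<dots> = ?c * (?g x + ?g (x - a j))"
      by (subst ennreal_mult) (simp_all del: cdf_deriv.simps)
    finally show ?thesis .
  qed
  then have "(\<integral>\<^sup>+ x. ennreal (\<bar>cdf_deriv a (Suc (Suc k)) j x\<bar> powr p) \<partial>lborel)
      \<le> (\<integral>\<^sup>+ x. ?c * (?g x + ?g (x - a j)) \<partial>lborel)"
    by (intro nn_integral_mono)
  also have "\<dots> = ?c * ((\<integral>\<^sup>+ x. ?g x \<partial>lborel) + (\<integral>\<^sup>+ x. ?g (x - a j) \<partial>lborel))"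
    by (simp add: nn_integral_cmult nn_integral_add del: cdf_deriv.simps)
  also have "\<dots> = ?c * ((\<integral>\<^sup>+ x. ?g x \<partial>lborel) + (\<integral>\<^sup>+ x. ?g x \<partial>lborel))"
    by (subst nn_integral_lborel_translate) auto
  also have "\<dots> \<le> ?c * (ennreal ?B + ennreal ?B)"
    by (intro mult_left_mono add_mono Suc.IH) simp
  also have "\<dots> = ennreal (a j powr - p * (?B + ?B))"
    by (simp only: ennreal_mult[OF powr_ge_zero add_nonneg_nonneg[OF B B]] ennreal_plus[OF B B]
        )
  also have "a j powr - p * (?B + ?B)
      = 2 ^ Suc (Suc k) * a (j + Suc k) / (\<Prod>i<Suc (Suc k). a (j + i)) powr p"
    using prod_a_pos[where j = "Suc j" and k = "Suc k"] a_pos[of j] unfolding prod_a_Suc[where k = "Suc k" and j = j]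
    by (simp add: powr_mult powr_minus_divide field_simps del: prod.lessThan_Suc)
  finally show ?case .
qed

section \<open>The test function\<close>

text \<open>The density of the law with distribution function \<open>box_cdf 0\<close>, scaled to
  take the value 1 at \<open>a 0\<close>. The factor \<open>a 0\<close> cancels the first width, so
  the bounds below involve only the product of \<open>a 1\<close>, ..., \<open>a k\<close>.\<close>

definition test_fun :: "real \<Rightarrow> 'a::real_normed_field" where
  "test_fun x = of_real (a 0 * cdf_deriv a (Suc 0) 0 x)"

lemma has_vector_derivative_test:
  "((\<lambda>x. of_real (a 0 * cdf_deriv a k 0 x) :: 'a::real_normed_field)
    has_vector_derivative of_real (a 0 * cdf_deriv a (Suc k) 0 x)) (at x)"
  by (intro has_vector_derivative_of_real DERIV_cmult cdf_deriv_has_real_derivative)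

lemma nth_deriv_test:
  "nth_deriv k (test_fun :: real \<Rightarrow> 'a::real_normed_field)
    = (\<lambda>x. of_real (a 0 * cdf_deriv a (Suc k) 0 x))"
proof (induction k)
  case 0
  then show ?case by (simp add: nth_deriv_def test_fun_def[abs_def])
next
  case (Suc k)
  then have "nth_deriv (Suc k) (test_fun :: real \<Rightarrow> 'a)
      = (\<lambda>x. vector_derivative (\<lambda>x. of_real (a 0 * cdf_deriv a (Suc k) 0 x)) (at x))"
    by (simp add: nth_deriv_def del: cdf_deriv.simps)
  also have "\<dots> = (\<lambda>x. of_real (a 0 * cdf_deriv a (Suc (Suc k)) 0 x))"
    by (intro ext vector_derivative_at has_vector_derivative_test)
  finally show ?case .
qed

lemma smooth_test: "smooth (test_fun :: real \<Rightarrow> 'a::real_normed_field)"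
  unfolding smooth_def nth_deriv_test
  using has_vector_derivative_test differentiableI_vector by blast

text \<open>Evaluating \<open>test_fun\<close> at \<open>a 0\<close> needs the endpoint 0, which
  \<open>box_cdf_eq_0\<close> leaves to continuity.\<close>

lemma box_cdf_0: "box_cdf k 0 = 0"
proof -
  have "(box_cdf k \<longlongrightarrow> box_cdf k 0) (at_left 0)"
    using isCont_box_cdf[where k = k and x = 0] unfolding isCont_def by (rule tendsto_mono[OF at_le, rotated]) simp
  moreover have "\<forall>\<^sub>F x in at_left 0. box_cdf k x = 0"
    using box_cdf_eq_0 by (auto simp: eventually_at_filter)
  then have "(box_cdf k \<longlongrightarrow> 0) (at_left 0)"
    by (rule tendsto_eventually)
  ultimately show ?thesis
    using tendsto_unique trivial_limit_at_left_real by blast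
qed

lemma sup_norm_test_ge: "1 \<le> sup_norm (test_fun :: real \<Rightarrow> 'a::real_normed_field)"
proof -
  have "box_cdf (Suc 0) (a 0) = 1"
    using a_half[of 0] by (intro box_cdf_eq_1) simp
  then have "(test_fun (a 0) :: 'a) = 1"
    using a_pos[of 0] by (simp add: test_fun_def box_cdf_0)
  then show ?thesis
    unfolding sup_norm_def by (intro SUP_upper2[of "a 0"]) auto
qed

lemma sup_norm_nth_deriv_test_le:
  "sup_norm (nth_deriv k (test_fun :: real \<Rightarrow> 'a::real_normed_field))
    \<le> ennreal (2 ^ Suc k / (\<Prod>i<k. a (Suc i)))"
proof -
  have "\<bar>a 0 * cdf_deriv a (Suc k) 0 x\<bar> \<le> 2 ^ Suc k / (\<Prod>i<k. a (Suc i))" for x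
  proof -
    have "\<bar>a 0 * cdf_deriv a (Suc k) 0 x\<bar> \<le> a 0 * (2 ^ Suc k / (\<Prod>i<Suc k. a (0 + i)))"
      unfolding abs_mult using a_pos[of 0] by (intro mult_mono cdf_deriv_bound) auto
    also have "\<dots> = 2 ^ Suc k / (\<Prod>i<k. a (Suc i))"
      unfolding prod_a_Suc using a_pos[of 0] by simp
    finally show ?thesis .
  qed
  then show ?thesis
    unfolding sup_norm_def nth_deriv_test norm_of_real by (intro SUP_least ennreal_leI)
qed

lemma Lp_norm_nth_deriv_test_le:
  assumes "0 < p" "p \<le> 1"
  shows "Lp_norm p (nth_deriv k (test_fun :: real \<Rightarrow> 'a::real_normed_field))
    \<le> ennreal ((2 ^ Suc k * a k / (\<Prod>i<k. a (Suc i)) powr p) powr (1 / p))"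
proof -
  let ?I = "\<integral>\<^sup>+ x. ennreal (norm (nth_deriv k (test_fun :: real \<Rightarrow> 'a) x) powr p) \<partial>lebesgue"
  let ?P = "\<Prod>i<k. a (Suc i)"
  let ?B = "2 ^ Suc k * a k / ?P powr p"
  have "?I = (\<integral>\<^sup>+ x. ennreal (a 0 powr p) * ennreal (\<bar>cdf_deriv a (Suc k) 0 x\<bar> powr p) \<partial>lborel)"
    using a_pos[of 0] unfolding nth_deriv_test norm_of_real
    by (simp add: nn_integral_completion abs_mult powr_mult ennreal_mult del: cdf_deriv.simps)
  also have "\<dots> = ennreal (a 0 powr p) * (\<integral>\<^sup>+ x. ennreal (\<bar>cdf_deriv a (Suc k) 0 x\<bar> powr p) \<partial>lborel)"
    by (rule nn_integral_cmult) (simp del: cdf_deriv.simps)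
  also have "\<dots> \<le> ennreal (a 0 powr p) *
      ennreal (2 ^ Suc k * a (0 + k) / (\<Prod>i<Suc k. a (0 + i)) powr p)"
    using assms by (intro mult_left_mono nn_integral_cdf_deriv) auto
  also have "\<dots> = ennreal ?B"
    using a_pos[of 0] prod_a_pos[of "Suc 0" k] a_pos[of k] unfolding prod_a_Suc
    by (simp add: ennreal_mult[symmetric] powr_mult)
  finally have I: "?I \<le> ennreal ?B" .
  have B: "0 \<le> ?B" using a_pos[of k] by simp
  from I have "?I \<noteq> \<infinity>" by (metis ennreal_less_top infinity_ennreal_def le_less_trans less_irrefl)
  moreover have "enn2real ?I \<le> ?B"
    using B I by (rule enn2real_leI)
  ultimately show ?thesis
    using assms unfolding Lp_norm_def ennreal_powr_def
    by (simp add: ennreal_leI powr_mono2)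
qed

end

section \<open>Choice of the logarithmic widths\<close>

lemma power_times_quadratic_tendsto_0:
  fixes q A B D :: real
  assumes "0 < q" "q < 1"
  shows "(\<lambda>k. q ^ k * (A + B * real k + D * (real k)\<^sup>2)) \<longlonglongrightarrow> 0"
proof -
  have 1: "(\<lambda>k. real k * q ^ k) \<longlonglongrightarrow> 0"
    using assms powser_times_n_limit_0[of q] by simp
  \<comment> \<open>k^2 q^k is the square of k (sqrt q)^k, so the limit for a linear factor
    applies.\<close>
  have 2: "(\<lambda>k. (real k * sqrt q ^ k) * (real k * sqrt q ^ k)) \<longlonglongrightarrow> 0 * 0"
    using assms powser_times_n_limit_0[of "sqrt q"] by (intro tendsto_mult) auto
  have "(\<lambda>k. A * q ^ k + B * (real k * q ^ k) + D * ((real k * sqrt q ^ k) * (real k * sqrt q ^ k)))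
      \<longlonglongrightarrow> A * 0 + B * 0 + D * (0 * 0)"
    using assms by (intro tendsto_intros 1 2 LIMSEQ_power_zero) auto
  moreover have "sqrt q ^ k * sqrt q ^ k = q ^ k" for k
    using assms by (simp flip: power_mult_distrib)
  ultimately show ?thesis by (simp add: algebra_simps power2_eq_square)
qed

lemma eventually_le_imp_le_up_to_const:
  fixes f g :: "nat \<Rightarrow> real"
  assumes "\<forall>\<^sub>F k in sequentially. f k \<le> g k"
  shows "\<exists>K. \<forall>k. f k - K \<le> g k"
proof -
  obtain N where N: "\<And>k. N \<le> k \<Longrightarrow> f k \<le> g k"
    using assms by (auto simp: eventually_sequentially)
  define K where "K = (\<Sum>k<N. \<bar>f k - g k\<bar>)"
  have "f k - K \<le> g k" for k
  proof (cases "k < N")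
    case True
    then have "\<bar>f k - g k\<bar> \<le> K" unfolding K_def by (intro member_le_sum) auto
    then show ?thesis by linarith
  next
    case False
    moreover have "0 \<le> K" unfolding K_def by (rule sum_nonneg) simp
    ultimately show ?thesis using N[of k] by linarith
  qed
  then show ?thesis by blast
qed

text \<open>\<open>E k\<close> is the average of \<open>z (k + 1 + j)\<close> with weights
  \<open>(1 - q) * q ^ j\<close>, truncated to j < n. Averaging preserves monotonicity and
  convexity; n makes \<open>E 0\<close> large, and the linear growth of z gives that of E.\<close>

lemma exists_subsolution:
  fixes y :: "nat \<Rightarrow> real"
  assumes q: "0 < q" "q < 1"
    and y_nonneg: "\<And>k. 0 \<le> y k" and "incseq y"
    and convex: "\<And>k. 2 * y (Suc k) \<le> y k + y (Suc (Suc k))"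
    and unbounded: "\<And>B. \<exists>n. B < (\<Sum>j<n. q ^ j * y (Suc j))"
  obtains E :: "nat \<Rightarrow> real" and A D :: real
  where "B < E 0" and "\<And>k. E k \<le> E (Suc k)"
    and "\<And>k. 2 * E (Suc k) \<le> E k + E (Suc (Suc k))"
    and "\<And>k. E k \<le> q * E (Suc k) + (1 - q) * y (Suc k)"
    and "\<And>k. E k \<le> A + D * real k"
proof -
  obtain n where n: "B / (1 - q) < (\<Sum>j<n. q ^ j * y (Suc j))"
    using unbounded by blast
  define d where "d k = y (Suc k) - y k" for k
  have d_nonneg: "0 \<le> d k" for k
    using \<open>incseq y\<close> by (simp add: d_def incseq_SucD)
  have "incseq d"
    using convex by (intro incseq_SucI) (simp add: d_def algebra_simps)
  \<comment> \<open>\<open>y\<close>, continued linearly beyond \<open>n + 1\<close>: this preserves convexity and makes \<open>E\<close> grow linearly\<close>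
  define z where "z k = y 0 + (\<Sum>i<k. d (min i n))" for k
  have y_eq: "y k = y 0 + (\<Sum>i<k. d i)" for k
    unfolding d_def by (simp add: sum_lessThan_telescope)
  have z_Suc: "z (Suc k) = z k + d (min k n)" for k by (simp add: z_def)
  have z_le: "z k \<le> y k" for k
    unfolding z_def y_eq[of k] using \<open>incseq d\<close> by (auto intro!: sum_mono simp: incseq_def)
  have z_eq: "z (Suc j) = y (Suc j)" if "j < n" for j
    unfolding z_def y_eq[of "Suc j"] using that by (auto intro!: sum.cong)
  have z_nonneg: "0 \<le> z k" for k
    unfolding z_def using y_nonneg d_nonneg by (auto intro!: add_nonneg_nonneg sum_nonneg)
  have z_lin: "z k \<le> y 0 + d n * real k" for k
  proof -
    have "(\<Sum>i<k. d (min i n)) \<le> (\<Sum>i<k. d n)"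
      using \<open>incseq d\<close> by (intro sum_mono) (auto simp: incseq_def)
    then show ?thesis by (simp add: z_def mult.commute)
  qed
  have z_convex: "2 * z (Suc k) \<le> z k + z (Suc (Suc k))" for k
    using \<open>incseq d\<close>[unfolded incseq_def, rule_format, of "min k n" "min (Suc k) n"]
    by (simp add: z_Suc min_le_iff_disj)
  define w where "w j = (1 - q) * q ^ j" for j
  have w: "0 \<le> w j" "w j \<le> 1" for j
    using q by (auto simp: w_def intro!: mult_le_one power_le_one)
  define E where "E k = (\<Sum>j<n. w j * z (Suc (k + j)))" for k
  show ?thesis
  proof
    have "E 0 = (1 - q) * (\<Sum>j<n. q ^ j * y (Suc j))"
      by (simp add: E_def w_def z_eq sum_distrib_left mult.assoc)
    then show "B < E 0"
      using n q by (simp add: field_simps)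
    show "E k \<le> E (Suc k)" for k
      unfolding E_def using d_nonneg w by (intro sum_mono mult_left_mono) (auto simp: z_Suc)
    show "2 * E (Suc k) \<le> E k + E (Suc (Suc k))" for k
    proof -
      have "2 * E (Suc k) = (\<Sum>j<n. w j * (2 * z (Suc (Suc k + j))))"
        by (simp add: E_def sum_distrib_left algebra_simps)
      also have "\<dots> \<le> (\<Sum>j<n. w j * (z (Suc (k + j)) + z (Suc (Suc (Suc k) + j))))"
        using z_convex w by (intro sum_mono mult_left_mono) auto
      also have "\<dots> = E k + E (Suc (Suc k))"
        by (simp add: E_def sum.distrib algebra_simps)
      finally show ?thesis .
    qed
    show "E k \<le> q * E (Suc k) + (1 - q) * y (Suc k)" for k
    proof -
      \<comment> \<open>Adding the nonnegative term j = n makes the shifted sum exactly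
        \<open>q * E (Suc k)\<close>.\<close>
      have "E k \<le> (\<Sum>j<Suc n. w j * z (Suc (k + j)))"
        unfolding E_def using w z_nonneg by simp
      also have "\<dots> = (1 - q) * z (Suc k) + q * E (Suc k)"
        by (subst sum.lessThan_Suc_shift) (simp add: E_def w_def sum_distrib_left algebra_simps)
      also have "\<dots> \<le> q * E (Suc k) + (1 - q) * y (Suc k)"
        using z_le[of "Suc k"] q by simp
      finally show ?thesis .
    qed
    show "E k \<le> real n * (y 0 + d n * real (Suc n)) + (real n * d n) * real k" for k
    proof -
      have "E k \<le> (\<Sum>j<n. y 0 + d n * real (Suc (k + n)))"
        unfolding E_def
      proof (intro sum_mono)
        fix j assume "j \<in> {..<n}"
        have "w j * z (Suc (k + j)) \<le> 1 * z (Suc (k + j))"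
          using w z_nonneg by (intro mult_right_mono) auto
        also have "\<dots> \<le> y 0 + d n * real (Suc (k + j))"
          unfolding mult_1_left by (rule z_lin)
        also have "\<dots> \<le> y 0 + d n * real (Suc (k + n))"
          using \<open>j \<in> {..<n}\<close> d_nonneg by (intro add_left_mono mult_left_mono) auto
        finally show "w j * z (Suc (k + j)) \<le> y 0 + d n * real (Suc (k + n))" .
      qed
      then show ?thesis by (simp add: algebra_simps)
    qed
  qed
qed

text \<open>Here \<open>\<beta> k\<close> stands for \<open>- ln (a k)\<close> and
  \<open>m k\<close> for \<open>ln (M k)\<close>. The conclusions say that the widths halve, that
  the k-th derivative of the test function has p-norm at most exp (-L) \<open>M k\<close>, and that
  the limsup condition of the class holds.\<close>

lemma exists_log_widths:
  fixes y m :: "nat \<Rightarrow> real"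
  assumes q: "0 < q" "q < 1" and p: "p = 1 - q"
    and y: "\<And>k. 0 \<le> y k" "incseq y"
      "\<And>k. 2 * y (Suc k) \<le> y k + y (Suc (Suc k))"
      "\<And>B. \<exists>n. B < (\<Sum>j<n. q ^ j * y (Suc j))"
    and m_nonneg: "\<And>k. 0 \<le> m k"
    and dominated: "\<And>b. \<exists>K. \<forall>k. y k + b * real k + (real k)\<^sup>2 - K \<le> m k"
    and "0 \<le> L"
  obtains \<beta> :: "nat \<Rightarrow> real"
  where "\<And>k. \<beta> k + ln 2 \<le> \<beta> (Suc k)"
    and "\<And>k. real (Suc k) * ln 2 - \<beta> k + p * (\<Sum>j<k. \<beta> (Suc j)) \<le> p * (m k - L)"
    and "(\<lambda>k. q ^ k * (real (Suc k) * ln 2 + (\<Sum>j<k. \<beta> (Suc j)))) \<longlonglongrightarrow> 0"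
proof -
  have p_pos: "0 < p" using q p by simp
  \<comment> \<open>the quadratic term of \<open>e\<close> below makes its increments grow by at least \<open>ln 2\<close>; the linear term
    keeps this true from index 0 to index 1\<close>
  define l where "l = p * L + 2"
  have "2 \<le> l" using p_pos \<open>0 \<le> L\<close> by (simp add: l_def)
  have ln2: "0 < ln (2::real)" "ln 2 \<le> (1::real)" using ln_2_less_1 by auto
  \<comment> \<open>After multiplication by p, the slope 1 / p pays for k of the k + 1 that bounds
    \<open>real (Suc k) * ln 2\<close>. The lower bound on \<open>E 0\<close> pays for the remaining
    1 and for K and L.\<close>
  obtain K where K: "\<And>k. y k + (l + 1 / p) * real k + (real k)\<^sup>2 - K \<le> m k"
    using dominated by blast
  obtain E A D where E_0: "K + L + 1 / p < E 0" and E_mono: "\<And>k. E k \<le> E (Suc k)"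
    and E_convex: "\<And>k. 2 * E (Suc k) \<le> E k + E (Suc (Suc k))"
    and E_sub: "\<And>k. E k \<le> q * E (Suc k) + (1 - q) * y (Suc k)"
    and E_lin: "\<And>k. E k \<le> A + D * real k"
    using exists_subsolution[OF q y, of "K + L + 1 / p"] by blast
  define e where "e k = E k + l * real k + (real k)\<^sup>2" for k
  \<comment> \<open>\<open>\<beta> 0\<close> does not occur in the sums; its value settles the norm
    condition at k = 0, where only \<open>m 0 \<ge> 0\<close> is available.\<close>
  define \<beta> where "\<beta> k = (case k of 0 \<Rightarrow> ln 2 + p * L | Suc i \<Rightarrow> e (Suc i) - e i)" for k
  have sum_\<beta>: "(\<Sum>j<k. \<beta> (Suc j)) = e k - E 0" for k
    by (simp add: \<beta>_def sum_lessThan_telescope) (simp add: e_def)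
  show ?thesis
  proof
    fix k
    show "\<beta> k + ln 2 \<le> \<beta> (Suc k)"
    proof (cases k)
      case 0
      then show ?thesis
        using E_mono[of 0] ln2 by (simp add: \<beta>_def e_def l_def)
    next
      case (Suc i)
      then show ?thesis
        using E_convex[of i] ln2 by (simp add: \<beta>_def e_def power2_eq_square algebra_simps)
    qed
    show "real (Suc k) * ln 2 - \<beta> k + p * (\<Sum>j<k. \<beta> (Suc j)) \<le> p * (m k - L)"
    proof (cases k)
      case 0
      then show ?thesis
        using m_nonneg[of 0] p_pos by (simp add: \<beta>_def algebra_simps)
    next
      case (Suc i)
      define T where "T k = l * real k + (real k)\<^sup>2" for k
      have T: "T i \<le> T k"
        unfolding T_def Suc using \<open>2 \<le> l\<close> by (intro add_mono mult_left_mono power_mono) auto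
      have "p * (y k + (l + 1 / p) * real k + (real k)\<^sup>2 - K) \<le> p * m k"
        using K p_pos by (intro mult_left_mono) auto
      then have 1: "p * y k + p * T k + real k - p * K \<le> p * m k"
        using p_pos by (simp add: T_def algebra_simps)
      have 2: "p * K + p * L + 1 \<le> p * E 0"
        using E_0 p_pos by (simp add: field_simps)
      have 3: "real (Suc k) * ln 2 \<le> real (Suc k)"
        using ln2 mult_left_mono[of "ln 2" 1 "real (Suc k)"] by simp
      have 4: "E i \<le> E k - p * E k + p * y k"
        using E_sub[of i] by (simp add: p Suc algebra_simps)
      have "\<beta> k = E k + T k - E i - T i"
        by (simp add: \<beta>_def Suc e_def T_def)
      moreover have "p * (\<Sum>j<k. \<beta> (Suc j)) = p * E k + p * T k - p * E 0"
        by (simp add: sum_\<beta> e_def T_def algebra_simps)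
      moreover have "p * (m k - L) = p * m k - p * L"
        by (rule right_diff_distrib)
      ultimately show ?thesis
        using 1 2 3 4 T by linarith
    qed
  next
    \<comment> \<open>\<open>e\<close> grows at most quadratically, which the factor q^k
      outweighs.\<close>
    let ?S = "\<lambda>k. real (Suc k) * ln 2 + (e k - E 0)"
    have "E 0 \<le> E k" for k
      using E_mono by (induction k) (auto intro: order_trans)
    then have "E 0 \<le> e k" for k
      using \<open>2 \<le> l\<close> by (auto simp: e_def add.assoc intro!: add_increasing2)
    then have lower: "0 \<le> q ^ k * ?S k" for k
      using q ln2 by (auto intro!: mult_nonneg_nonneg add_nonneg_nonneg)
    have upper: "q ^ k * ?S k \<le> q ^ k * ((A - E 0 + ln 2) + (D + l + ln 2) * real k + 1 * (real k)\<^sup>2)" for k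
      using q E_lin[of k] by (intro mult_left_mono) (auto simp: e_def algebra_simps)
    have "(\<lambda>k. q ^ k * ?S k) \<longlonglongrightarrow> 0"
      by (rule tendsto_sandwich[OF always_eventually always_eventually tendsto_const
            power_times_quadratic_tendsto_0[OF q]]) (use lower upper in blast)+
    then show "(\<lambda>k. q ^ k * (real (Suc k) * ln 2 + (\<Sum>j<k. \<beta> (Suc j)))) \<longlonglongrightarrow> 0"
      by (simp only: sum_\<beta>)
  qed
qed

section \<open>Members of the class with small weighted norm\<close>

lemma ennreal_powr_le:
  assumes "x \<le> ennreal B" "0 \<le> B" "0 \<le> a"
  shows "ennreal_powr x a \<le> ennreal (B powr a)"
proof -
  have "x \<noteq> \<infinity>" using assms(1) by (auto simp: top_unique)
  then show ?thesis
    using assms by (auto simp: ennreal_powr_def intro!: ennreal_leI powr_mono2 enn2real_leI)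
qed

text \<open>The test function for the widths exp (-\<beta> k), with L = - ln \<delta>;
  exponentiating the conditions on \<beta> gives the norm bounds.\<close>

lemma exists_test_function:
  fixes y M :: "nat \<Rightarrow> real"
  assumes q: "0 < q" "q < 1" and p: "p = 1 - q"
    and y: "\<And>k. 0 \<le> y k" "incseq y"
      "\<And>k. 2 * y (Suc k) \<le> y k + y (Suc (Suc k))"
      "\<And>B. \<exists>n. B < (\<Sum>j<n. q ^ j * y (Suc j))"
    and M: "\<And>k. 1 \<le> M k"
    and dominated: "\<And>b. \<exists>K. \<forall>k. y k + b * real k + (real k)\<^sup>2 - K \<le> ln (M k)"
    and \<delta>: "0 < \<delta>" "\<delta> \<le> 1"
  obtains f :: "real \<Rightarrow> 'a::real_normed_field"
  where "f \<in> class_S p M" and "1 \<le> sup_norm f" and "weighted_norm p M f \<le> ennreal \<delta>"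
proof -
  have p_pos: "0 < p" "p \<le> 1" using q p by auto
  have m_nonneg: "0 \<le> ln (M k)" for k using M[of k] by simp
  have L: "0 \<le> - ln \<delta>" using \<delta> by simp
  obtain \<beta> :: "nat \<Rightarrow> real" where \<beta>_step: "\<And>k. \<beta> k + ln 2 \<le> \<beta> (Suc k)"
    and \<beta>_M: "\<And>k. real (Suc k) * ln 2 - \<beta> k + p * (\<Sum>j<k. \<beta> (Suc j)) \<le> p * (ln (M k) - - ln \<delta>)"
    and \<beta>_lim: "(\<lambda>k. q ^ k * (real (Suc k) * ln 2 + (\<Sum>j<k. \<beta> (Suc j)))) \<longlonglongrightarrow> 0"
    using exists_log_widths[OF q p y m_nonneg dominated L] by blast
  define a where "a k = exp (- \<beta> k)" for k
  define S where "S k = (\<Sum>j<k. \<beta> (Suc j))" for k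
  interpret halving_seq a
  proof
    show "0 < a k" for k by (simp add: a_def)
    show "a (Suc k) \<le> a k / 2" for k
    proof -
      have "a (Suc k) \<le> exp (- \<beta> k - ln 2)" using \<beta>_step[of k] by (simp add: a_def)
      then show ?thesis by (simp add: a_def exp_diff)
    qed
  qed
  have prod_a: "(\<Prod>i<k. a (Suc i)) = exp (- S k)" for k
    by (simp add: a_def S_def exp_sum[symmetric] sum_negf)
  have pow2: "(2::real) ^ k = exp (real k * ln 2)" for k
    by (simp add: exp_of_nat_mult)
  let ?f = "test_fun :: real \<Rightarrow> 'a"
  have "Lp_norm p (nth_deriv k ?f) / ennreal (M k) \<le> ennreal \<delta>" for k
  proof -
    have "(2 ^ Suc k * a k / (\<Prod>i<k. a (Suc i)) powr p) powr (1 / p)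
        = exp ((real (Suc k) * ln 2 - \<beta> k + p * S k) / p)"
      unfolding prod_a unfolding pow2 a_def
      by (simp add: powr_def exp_add[symmetric] exp_diff[symmetric] del: exp_add exp_diff)
    also have "\<dots> \<le> exp (ln (M k) + ln \<delta>)"
      using \<beta>_M[of k] p_pos by (simp add: S_def field_simps)
    also have "\<dots> = M k * \<delta>"
      using M[of k] \<delta> by (simp add: exp_add)
    finally have "Lp_norm p (nth_deriv k ?f) \<le> ennreal (M k * \<delta>)"
      using Lp_norm_nth_deriv_test_le[OF p_pos, of k] order_trans ennreal_leI by blast
    then have "Lp_norm p (nth_deriv k ?f) / ennreal (M k) \<le> ennreal (M k * \<delta>) / ennreal (M k)"
      by (rule divide_right_mono_ennreal)
    also have "\<dots> = ennreal \<delta>"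
      using M[of k] \<delta> by (simp add: divide_ennreal)
    finally show ?thesis .
  qed
  then have weighted: "weighted_norm p M ?f \<le> ennreal \<delta>"
    unfolding weighted_norm_def by (rule SUP_least)
  have "ennreal_powr (sup_norm (nth_deriv k ?f)) (q ^ k)
      \<le> ennreal (exp (q ^ k * (real (Suc k) * ln 2 + S k)))" for k
  proof -
    have "2 ^ Suc k / (\<Prod>i<k. a (Suc i)) = exp (real (Suc k) * ln 2 + S k)"
      unfolding prod_a unfolding pow2 by (simp only: exp_minus exp_add divide_inverse inverse_inverse_eq)
    then have "sup_norm (nth_deriv k ?f) \<le> ennreal (exp (real (Suc k) * ln 2 + S k))"
      using sup_norm_nth_deriv_test_le[of k, where 'a = 'a] by simp
    then have "ennreal_powr (sup_norm (nth_deriv k ?f)) (q ^ k)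
        \<le> ennreal (exp (real (Suc k) * ln 2 + S k) powr (q ^ k))"
      using q by (intro ennreal_powr_le) auto
    then show ?thesis by (simp only: powr_def exp_not_eq_zero ln_exp if_False)
  qed
  then have "limsup (\<lambda>k. ennreal_powr (sup_norm (nth_deriv k ?f)) (q ^ k))
      \<le> limsup (\<lambda>k. ennreal (exp (q ^ k * (real (Suc k) * ln 2 + S k))))"
    by (intro Limsup_mono always_eventually) blast
  also have "(\<lambda>k. ennreal (exp (q ^ k * (real (Suc k) * ln 2 + S k)))) \<longlonglongrightarrow> ennreal (exp 0)"
    using \<beta>_lim unfolding S_def by (intro tendsto_ennrealI tendsto_exp)
  then have "limsup (\<lambda>k. ennreal (exp (q ^ k * (real (Suc k) * ln 2 + S k)))) = 1"
    by (intro lim_imp_Limsup) auto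
  finally have "?f \<in> class_S p M"
    using weighted smooth_test le_less_trans[OF weighted ennreal_less_top] p
    by (simp add: class_S_def)
  then show ?thesis using that sup_norm_test_ge weighted by blast
qed

section \<open>Convex minorants in the two growth cases\<close>

theorem theorem3p3:
  fixes p q :: real and M :: "nat \<Rightarrow> real"
  assumes "0 < p" and "p < 1" and "q = 1 - p"
    and "\<And>k. M k \<ge> 1"
    and "mu_infinite p M"
    and "liminf (\<lambda>k. ereal (q ^ k * ln (M k))) > 0 \<or>
         (incseq (\<lambda>k. ln (M k)) \<and> convex_seq (\<lambda>k. ln (M k)) \<and>
          (\<lambda>k. q ^ k * ln (M k)) \<longlonglongrightarrow> 0 \<and>
          (\<forall>P :: real poly. lead_coeff P > 0 \<longrightarrow>
             liminf (\<lambda>k. ereal (ln (M k) / poly P (real k))) = \<infinity>))"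
  shows "\<not> (\<exists>C :: real. \<forall>f \<in> (class_S p M :: (real \<Rightarrow> 'a::real_normed_field) set).
             sup_norm f \<le> ennreal C * weighted_norm p M f)"
proof
  assume "\<exists>C :: real. \<forall>f \<in> (class_S p M :: (real \<Rightarrow> 'a) set).
             sup_norm f \<le> ennreal C * weighted_norm p M f"
  then obtain C where C: "\<And>f :: real \<Rightarrow> 'a. f \<in> class_S p M \<Longrightarrow>
      sup_norm f \<le> ennreal C * weighted_norm p M f" by blast
  have q: "0 < q" "q < 1" and p: "p = 1 - q" using assms by auto
  have m_nonneg: "0 \<le> ln (M k)" for k using assms(4)[of k] by simp
  have "\<exists>y. (\<forall>k. 0 \<le> y k) \<and> incseq y \<and> (\<forall>k. 2 * y (Suc k) \<le> y k + y (Suc (Suc k))) \<and>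
      (\<forall>B. \<exists>n. B < (\<Sum>j<n. q ^ j * y (Suc j))) \<and>
      (\<forall>b. \<exists>K. \<forall>k. y k + b * real k + (real k)\<^sup>2 - K \<le> ln (M k))"
    using assms(6)
  proof
    assume "liminf (\<lambda>k. ereal (q ^ k * ln (M k))) > 0"
    then obtain c where "0 < ereal c" "ereal c < liminf (\<lambda>k. ereal (q ^ k * ln (M k)))"
      using ereal_dense2 by blast
    then have c: "0 < c" and ev: "\<forall>\<^sub>F k in sequentially. c < q ^ k * ln (M k)"
      using less_LiminfD by fastforce+
    \<comment> \<open>Half of the eventual lower bound c / q^k of \<open>ln (M k)\<close>. The terms
      \<open>q ^ j * y (Suc j)\<close> are all equal to c / (2 q), so their sums are
      unbounded.\<close>
    define y where "y k = c / 2 / q ^ k" for k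
    have y_Suc: "y (Suc k) = y k / q" for k by (simp add: y_def)
    have y_pos: "0 < y k" for k using c q by (simp add: y_def)
    show ?thesis
    proof (intro exI[of _ y] conjI allI)
      fix k
      show "0 \<le> y k" using y_pos less_imp_le by blast
      show "2 * y (Suc k) \<le> y k + y (Suc (Suc k))"
      proof -
        have "y k + y (Suc (Suc k)) - 2 * y (Suc k) = y k * (1 - 1 / q)\<^sup>2"
          using q by (simp add: y_Suc power2_eq_square field_simps)
        moreover have "0 \<le> y k * (1 - 1 / q)\<^sup>2" using y_pos[of k] by simp
        ultimately show ?thesis by linarith
      qed
    next
      show "incseq y"
        using q y_pos by (intro incseq_SucI) (simp add: y_Suc field_simps)
    next
      fix B
      obtain n where "B < real n * (c / (2 * q))"
        using reals_Archimedean3[of "c / (2 * q)"] c q by auto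
      moreover have "q ^ j * y (Suc j) = c / (2 * q)" for j
        using q by (simp add: y_def)
      ultimately have "B < (\<Sum>j<n. q ^ j * y (Suc j))" by simp
      then show "\<exists>n. B < (\<Sum>j<n. q ^ j * y (Suc j))" ..
    next
      fix b
      \<comment> \<open>The other half of c absorbs the quadratic term.\<close>
      have "\<forall>\<^sub>F k in sequentially. q ^ k * (0 + b * real k + 1 * (real k)\<^sup>2) < c / 2"
        using c by (intro order_tendstoD(2)[OF power_times_quadratic_tendsto_0[OF q]]) simp
      with ev have "\<forall>\<^sub>F k in sequentially. y k + b * real k + (real k)\<^sup>2 \<le> ln (M k)"
      proof eventually_elim
        case (elim k)
        have "q ^ k * y k = c / 2" using q by (simp add: y_def)
        then have "q ^ k * (y k + b * real k + (real k)\<^sup>2) \<le> q ^ k * ln (M k)"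
          using elim by (simp add: algebra_simps)
        then show ?case using q by simp
      qed
      then show "\<exists>K. \<forall>k. y k + b * real k + (real k)\<^sup>2 - K \<le> ln (M k)"
        by (rule eventually_le_imp_le_up_to_const)
    qed
  next
    assume *: "incseq (\<lambda>k. ln (M k)) \<and> convex_seq (\<lambda>k. ln (M k)) \<and>
          (\<lambda>k. q ^ k * ln (M k)) \<longlonglongrightarrow> 0 \<and>
          (\<forall>P :: real poly. lead_coeff P > 0 \<longrightarrow>
             liminf (\<lambda>k. ereal (ln (M k) / poly P (real k))) = \<infinity>)"
    define y where "y k = ln (M k) / 2" for k
    show ?thesis
    proof (intro exI[of _ y] conjI allI)
      fix k
      show "0 \<le> y k" using m_nonneg by (simp add: y_def)
      have "ln (M (k + 2)) + ln (M (k + 2 - 2)) - 2 * ln (M (k + 2 - 1)) \<ge> 0"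
        using *[THEN conjunct2, THEN conjunct1, unfolded convex_seq_def, rule_format, of "k + 2"] by simp
      then show "2 * y (Suc k) \<le> y k + y (Suc (Suc k))"
        by (simp add: y_def)
    next
      show "incseq y" using * by (simp add: y_def incseq_def)
    next
      fix B
      \<comment> \<open>The logarithm of the product of the first n + 1 factors is p / q times
        \<open>ln (M 0)\<close>, from index 0, plus 2 p times the sum to be bounded below.\<close>
      define X where "X = p / q * ln (M 0) + 2 * p * B"
      have "\<forall>\<^sub>F n in sequentially. exp X < (\<Prod>k<n. M k powr (p * (1 - p) powi (int k - 1)))"
        using assms(5) unfolding mu_infinite_def by (rule filterlim_at_top_dense[THEN iffD1, rule_format])
      then obtain n where "exp X < (\<Prod>k<Suc n. M k powr (p * (1 - p) powi (int k - 1)))"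
        unfolding eventually_sequentially using le_SucI by blast
      also have "\<dots> = exp (\<Sum>k<Suc n. p * q powi (int k - 1) * ln (M k))"
      proof -
        have "M k powr (p * (1 - p) powi (int k - 1)) = exp (p * q powi (int k - 1) * ln (M k))" for k
          using assms(4)[of k] by (simp add: powr_def p)
        then show ?thesis by (simp only: exp_sum[OF finite_lessThan])
      qed
      finally have "X < (\<Sum>k<Suc n. p * q powi (int k - 1) * ln (M k))" by simp
      also have "\<dots> = p / q * ln (M 0) + (\<Sum>k<n. p * q powi (int k) * ln (M (Suc k)))"
        by (subst sum.lessThan_Suc_shift) (simp add: power_int_minus divide_inverse)
      also have "(\<Sum>k<n. p * q powi (int k) * ln (M (Suc k))) = 2 * p * (\<Sum>j<n. q ^ j * y (Suc j))"
        by (simp add: y_def sum_distrib_left mult.assoc)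
      finally have "B < (\<Sum>j<n. q ^ j * y (Suc j))"
        using \<open>0 < p\<close> by (simp add: X_def)
      then show "\<exists>n. B < (\<Sum>j<n. q ^ j * y (Suc j))" ..
    next
      fix b :: real
      \<comment> \<open>A nonnegative coefficient makes P positive at every index, so the quotient
        can be cleared. The value 2 below leaves P under half of \<open>ln (M k)\<close>.\<close>
      obtain b' where b': "0 \<le> b'" "b \<le> b'" by (metis linear)
      define P :: "real poly" where "P = [:1, b', 1:]"
      have "liminf (\<lambda>k. ereal (ln (M k) / poly P (real k))) = \<infinity>"
        by (rule *[THEN conjunct2, THEN conjunct2, THEN conjunct2, rule_format]) (simp add: P_def)
      then have "\<forall>\<^sub>F k in sequentially. ereal 2 < ereal (ln (M k) / poly P (real k))"
        by (intro less_LiminfD) simp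
      then have "\<forall>\<^sub>F k in sequentially. y k + b * real k + (real k)\<^sup>2 \<le> ln (M k)"
      proof eventually_elim
        case (elim k)
        have P: "poly P (real k) = 1 + b' * real k + (real k)\<^sup>2"
          by (simp add: P_def algebra_simps power2_eq_square)
        have "0 < poly P (real k)"
          unfolding P using b' by (intro add_pos_nonneg) auto
        then have "poly P (real k) < ln (M k) / 2"
          using elim by (simp add: field_simps)
        moreover have "b * real k \<le> b' * real k"
          using b' by (intro mult_right_mono) auto
        ultimately have "b * real k + (real k)\<^sup>2 \<le> ln (M k) / 2"
          unfolding P by linarith
        then show ?case
          unfolding y_def by (simp add: add.assoc)
      qed
      then show "\<exists>K. \<forall>k. y k + b * real k + (real k)\<^sup>2 - K \<le> ln (M k)"
        by (rule eventually_le_imp_le_up_to_const)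
    qed
  qed
  then obtain y :: "nat \<Rightarrow> real" where y: "\<And>k. 0 \<le> y k" "incseq y"
      "\<And>k. 2 * y (Suc k) \<le> y k + y (Suc (Suc k))"
      "\<And>B. \<exists>n. B < (\<Sum>j<n. q ^ j * y (Suc j))"
      "\<And>b. \<exists>K. \<forall>k. y k + b * real k + (real k)\<^sup>2 - K \<le> ln (M k)"
    by blast
  \<comment> \<open>The absolute value covers a negative C, and the added 1 makes the product of |C|
    and \<delta> smaller than 1 while keeping \<delta> \<le> 1.\<close>
  define \<delta> where "\<delta> = 1 / (\<bar>C\<bar> + 1)"
  have \<delta>: "0 < \<delta>" "\<delta> \<le> 1" "\<bar>C\<bar> * \<delta> < 1" by (auto simp: \<delta>_def field_simps)
  obtain f :: "real \<Rightarrow> 'a" where f: "f \<in> class_S p M" "1 \<le> sup_norm f"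
      "weighted_norm p M f \<le> ennreal \<delta>"
    using exists_test_function[OF q p y(1-4) assms(4) y(5) \<delta>(1,2)] by blast
  have "1 \<le> ennreal C * weighted_norm p M f"
    using C[OF f(1)] f(2) by (rule order_trans[rotated])
  also have "\<dots> \<le> ennreal \<bar>C\<bar> * ennreal \<delta>"
    using f(3) by (intro mult_mono ennreal_leI) auto
  also have "\<dots> = ennreal (\<bar>C\<bar> * \<delta>)"
    using \<delta> by (simp add: ennreal_mult)
  also have "\<dots> < 1"
    using \<delta> by (simp add: ennreal_less_one_iff)
  finally show False by simp
qed

end
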